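(* Let $I=[a,b]\subset\mathbb{R}$ be a compact interval. If $F:I\to\mathbb{R}$ is differentiable at every point in $I$ and $f=F'$, then $f$ is Sequential Henstock integrable on $I$ and $$\int_a^b f=F(b)-F(a).$$
   Context: Derivatives at the endpoints $a,b$ are one-sided. A tagged partition $P=\{([x_{i-1},x_i],t_i)\}_{i=1}^k$ of $I=[a,b]$ consists of points $a=x_0<x_1<\dots<x_k=b$ together with tags $t_i\in[x_{i-1},x_i]$. Its Riemann sum for $f$ is $S(f,P)=\sum_{i=1}^k f(t_i)(x_i-x_{i-1})$. A gauge on $I$ is a function $\delta:I\to\mathbb{R}$ with $\delta(x)>0$ for all $x\in I$. $P$ is $\delta(x)$-fine if $x_i-x_{i-1}<\delta(t_i)$ for every $i$. $f$ is Sequential Henstock integrable on $I$ with integral $A=\int_I f=\int_a^b f\in\mathbb{R}$ if there is a sequence of gauges $\{\delta_n\}_{n=1}^\infty$ on $I$ such that, whenever $P_n$ is a $\delta_n(x)$-fine tagged partition of $I$ for each $n$, one has $S(f,P_n)\to A$ as $n\to\infty$. The value of the integral is unique. *)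

theory Defs
  imports "HOL-Analysis.Analysis"
begin

text \<open>
  \<open>(k, x, t)\<close> stands for the tagged partition
  \<open>{([x (i - 1), x i], t i)}\<close> with \<open>i = 1, \<dots>, k\<close>. The values of \<open>x\<close> outside \<open>{0..k}\<close> and of
  \<open>t\<close> outside \<open>{1..k}\<close> are irrelevant. The library's tagged divisions are not used because they
  admit degenerate subintervals, and its gauges assign open sets, rather than positive
  numbers, to points.
\<close>
type_synonym tagged_points = "nat \<times> (nat \<Rightarrow> real) \<times> (nat \<Rightarrow> real)"

text \<open>The case \<open>k = 0\<close> occurs only for \<open>a = b\<close>.\<close>
definition tagged_partition :: "real \<Rightarrow> real \<Rightarrow> tagged_points \<Rightarrow> bool" where
  "tagged_partition a b = (\<lambda>(k, x, t).
     x 0 = a \<and> x k = b \<and>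
     (\<forall>i\<in>{1..k}. x (i - 1) < x i \<and> t i \<in> {x (i - 1)..x i}))"

definition riemann_sum :: "(real \<Rightarrow> real) \<Rightarrow> tagged_points \<Rightarrow> real" where
  "riemann_sum f = (\<lambda>(k, x, t). \<Sum>i = 1..k. f (t i) * (x i - x (i - 1)))"

definition gauge_on :: "real set \<Rightarrow> (real \<Rightarrow> real) \<Rightarrow> bool" where
  "gauge_on I \<delta> \<longleftrightarrow> (\<forall>x\<in>I. \<delta> x > 0)"

definition gauge_fine :: "(real \<Rightarrow> real) \<Rightarrow> tagged_points \<Rightarrow> bool" where
  "gauge_fine \<delta> = (\<lambda>(k, x, t). \<forall>i\<in>{1..k}. x i - x (i - 1) < \<delta> (t i))"

definition has_seq_henstock_integral ::
    "(real \<Rightarrow> real) \<Rightarrow> real \<Rightarrow> real \<Rightarrow> real \<Rightarrow> bool" where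
  "has_seq_henstock_integral f A a b \<longleftrightarrow>
     (\<exists>\<delta> :: nat \<Rightarrow> real \<Rightarrow> real.
        (\<forall>n. gauge_on {a..b} (\<delta> n)) \<and>
        (\<forall>P :: nat \<Rightarrow> tagged_points.
           (\<forall>n. tagged_partition a b (P n) \<and> gauge_fine (\<delta> n) (P n)) \<longrightarrow>
           (\<lambda>n. riemann_sum f (P n)) \<longlonglongrightarrow> A))"

definition seq_henstock_integrable :: "(real \<Rightarrow> real) \<Rightarrow> real \<Rightarrow> real \<Rightarrow> bool" where
  "seq_henstock_integrable f a b \<longleftrightarrow> (\<exists>A. has_seq_henstock_integral f A a b)"

definition seq_henstock_integral :: "(real \<Rightarrow> real) \<Rightarrow> real \<Rightarrow> real \<Rightarrow> real" where
  "seq_henstock_integral f a b = (THE A. has_seq_henstock_integral f A a b)"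

end

theory Submission
  imports Defs
begin

text \<open>
  Near a point \<open>t\<close> of \<open>[a, b]\<close>, the increment of \<open>F\<close> over a short interval \<open>[u, v]\<close> containing
  \<open>t\<close> is \<open>f t * (v - u)\<close> up to an error of at most \<open>\<epsilon> * (v - u)\<close>; how short the interval must be
  depends on \<open>t\<close>, and this is exactly the freedom that a gauge offers
  (\<open>straddle_estimate\<close>). The increments of \<open>F\<close> telescope to \<open>F b - F a\<close> and the lengths to
  \<open>b - a\<close>, so every partition fine for this gauge has a Riemann sum within \<open>\<epsilon> * (b - a)\<close> of
  \<open>F b - F a\<close> (\<open>riemann_sum_close_to_increment\<close>). Gauges belonging to a null sequence of
  values of \<open>\<epsilon>\<close> thus witness that \<open>F b - F a\<close> is an integral of \<open>f\<close>.

  To identify it as the value of the integral, uniqueness is needed. It rests on Cousin's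
  lemma (\<open>cousin\<close>): if some gauge admitted no fine partition, every real number would vacuously
  be an integral.
\<close>

section \<open>Uniqueness of the integral\<close>

lemma tagged_partition_append:
  assumes P: "tagged_partition u v P" "gauge_fine \<delta> P"
    and Q: "tagged_partition v w Q" "gauge_fine \<delta> Q"
  shows "\<exists>R. tagged_partition u w R \<and> gauge_fine \<delta> R"
proof -
  obtain k x s where P_eq: "P = (k, x, s)" by (cases P)
  obtain m y t where Q_eq: "Q = (m, y, t)" by (cases Q)
  define z where "z i = (if i \<le> k then x i else y (i - k))" for i
  define r where "r i = (if i \<le> k then s i else t (i - k))" for i
  have ends: "x 0 = u" "x k = v" "y 0 = v" "y m = w"
    using P(1) Q(1) by (auto simp: tagged_partition_def P_eq Q_eq)
  have piece: "z (i - 1) < z i \<and> r i \<in> {z (i - 1)..z i} \<and> z i - z (i - 1) < \<delta> (r i)"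
    if i: "i \<in> {1..k + m}" for i
  proof (cases "i \<le> k")
    case True
    then have "z i = x i" "z (i - 1) = x (i - 1)" "r i = s i"
      by (auto simp: z_def r_def)
    then show ?thesis
      using P i True by (auto simp: tagged_partition_def gauge_fine_def P_eq)
  next
    case False
    define j where "j = i - k"
    have j: "j \<in> {1..m}" using i False by (auto simp: j_def)
    \<comment> \<open>At the seam \<open>i = k + 1\<close> the left endpoint is \<open>x k\<close>, which agrees with \<open>y 0\<close>.\<close>
    have "z (i - 1) = y (j - 1)"
    proof (cases "i = Suc k")
      case True
      then show ?thesis using ends by (simp add: z_def j_def)
    next
      case ne: False
      have "i - 1 - k = j - 1" by (simp add: j_def)
      moreover have "\<not> i - 1 \<le> k" using ne False by simp
      ultimately show ?thesis by (simp add: z_def)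
    qed
    moreover have "z i = y j" "r i = t j" using False by (auto simp: z_def r_def j_def)
    ultimately show ?thesis
      using Q j by (auto simp: tagged_partition_def gauge_fine_def Q_eq)
  qed
  have "z 0 = u" "z (k + m) = w" using ends by (auto simp: z_def)
  with piece have "tagged_partition u w (k + m, z, r) \<and> gauge_fine \<delta> (k + m, z, r)"
    by (auto simp: tagged_partition_def gauge_fine_def)
  then show ?thesis by blast
qed

text \<open>
  Having a fine partition is inherited by the union of two adjacent intervals, and it holds for
  all short intervals around a given point, which serves as the only tag. By compactness it
  therefore holds for the whole interval.
\<close>
lemma cousin:
  fixes a b :: real
  assumes "a \<le> b" and \<delta>: "gauge_on {a..b} \<delta>"
  shows "\<exists>P. tagged_partition a b P \<and> gauge_fine \<delta> P"
  using \<open>a \<le> b\<close>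
proof (induction rule: Bolzano)
  case (trans u v w)
  then show ?case using tagged_partition_append by blast
next
  case (local c)
  have "\<exists>P. tagged_partition u v P \<and> gauge_fine \<delta> P"
    if "u \<le> c" "c \<le> v" "v - u < \<delta> c" for u v
  proof (cases "u = v")
    case True
    then have "tagged_partition u v (0, \<lambda>_. u, \<lambda>_. c) \<and> gauge_fine \<delta> (0, \<lambda>_. u, \<lambda>_. c)"
      by (simp add: tagged_partition_def gauge_fine_def)
    then show ?thesis by blast
  next
    case False
    define x where "x i = (if i = 0 then u else v)" for i :: nat
    have "tagged_partition u v (1, x, \<lambda>_. c) \<and> gauge_fine \<delta> (1, x, \<lambda>_. c)"
      using that False by (simp add: tagged_partition_def gauge_fine_def x_def)
    then show ?thesis by blast
  qed
  moreover have "\<delta> c > 0" using local \<delta> by (simp add: gauge_on_def)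
  ultimately show ?case by blast
qed

text \<open>
  The pointwise minimum of two gauges is again a gauge. A sequence of partitions fine for the
  minima is fine for both sequences of gauges, so its Riemann sums converge to both integrals.
\<close>
lemma has_seq_henstock_integral_unique:
  fixes a b :: real
  assumes "a \<le> b"
    and "has_seq_henstock_integral f A a b" "has_seq_henstock_integral f B a b"
  shows "A = B"
proof -
  obtain \<delta> where \<delta>: "\<And>n. gauge_on {a..b} (\<delta> n)"
    and A: "\<And>P. (\<And>n. tagged_partition a b (P n) \<and> gauge_fine (\<delta> n) (P n)) \<Longrightarrow>
              (\<lambda>n. riemann_sum f (P n)) \<longlonglongrightarrow> A"
    using assms(2) unfolding has_seq_henstock_integral_def by blast
  obtain \<eta> where \<eta>: "\<And>n. gauge_on {a..b} (\<eta> n)"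
    and B: "\<And>P. (\<And>n. tagged_partition a b (P n) \<and> gauge_fine (\<eta> n) (P n)) \<Longrightarrow>
              (\<lambda>n. riemann_sum f (P n)) \<longlonglongrightarrow> B"
    using assms(3) unfolding has_seq_henstock_integral_def by blast
  have "\<exists>P. tagged_partition a b P \<and> gauge_fine (\<lambda>x. min (\<delta> n x) (\<eta> n x)) P" for n
    using \<delta> \<eta> by (intro cousin \<open>a \<le> b\<close>) (simp add: gauge_on_def)
  then obtain P where P: "\<And>n. tagged_partition a b (P n)"
    "\<And>n. gauge_fine (\<lambda>x. min (\<delta> n x) (\<eta> n x)) (P n)"
    by metis
  have "gauge_fine (\<delta> n) (P n) \<and> gauge_fine (\<eta> n) (P n)" for n
    using P(2)[of n] by (auto simp: gauge_fine_def split: prod.splits)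
  then show ?thesis using A[of P] B[of P] P(1) LIMSEQ_unique by blast
qed

section \<open>Riemann sums of a derivative\<close>

text \<open>
  The point \<open>t\<close> must lie between \<open>u\<close> and \<open>v\<close>: the errors of the linear approximation at the two
  endpoints are then at most \<open>\<epsilon> * (v - t)\<close> and \<open>\<epsilon> * (t - u)\<close>, and these add up to
  \<open>\<epsilon> * (v - u)\<close>.
\<close>
lemma straddle_estimate:
  fixes F :: "real \<Rightarrow> real"
  assumes "(F has_real_derivative D) (at t within I)" and "\<epsilon> > 0"
  shows "\<exists>d>0. \<forall>u\<in>I. \<forall>v\<in>I. u \<le> t \<longrightarrow> t \<le> v \<longrightarrow> v - u < d \<longrightarrow>
           \<bar>F v - F u - D * (v - u)\<bar> \<le> \<epsilon> * (v - u)"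
proof -
  have "(F has_derivative (*) D) (at t within I)"
    using assms(1) by (simp add: has_field_derivative_def)
  then obtain d where "d > 0"
    and d: "\<And>y. y \<in> I \<Longrightarrow> \<bar>y - t\<bar> < d \<Longrightarrow> \<bar>F y - F t - D * (y - t)\<bar> \<le> \<epsilon> * \<bar>y - t\<bar>"
    using \<open>\<epsilon> > 0\<close> unfolding has_derivative_within_alt real_norm_def by blast
  have "\<bar>F v - F u - D * (v - u)\<bar> \<le> \<epsilon> * (v - u)"
    if "u \<in> I" "v \<in> I" "u \<le> t" "t \<le> v" "v - u < d" for u v
  proof -
    have "\<bar>F v - F t - D * (v - t)\<bar> \<le> \<epsilon> * (v - t)" using d[of v] that by simp
    moreover have "\<bar>F u - F t - D * (u - t)\<bar> \<le> \<epsilon> * (t - u)" using d[of u] that by simp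
    moreover have "F v - F u - D * (v - u) =
        (F v - F t - D * (v - t)) - (F u - F t - D * (u - t))"
      by (simp add: algebra_simps)
    moreover have "\<epsilon> * (v - u) = \<epsilon> * (v - t) + \<epsilon> * (t - u)" by (simp add: algebra_simps)
    ultimately show ?thesis by linarith
  qed
  with \<open>d > 0\<close> show ?thesis by blast
qed

lemma partition_points_in_interval:
  assumes "tagged_partition a b (k, x, t)" and "i \<le> k"
  shows "x i \<in> {a..b}"
proof -
  have mono: "x j \<le> x (Suc j)" if "j < k" for j
    using assms(1) that by (force simp: tagged_partition_def Ball_def dest: spec[of _ "Suc j"])
  have "x 0 \<le> x i"
    using \<open>i \<le> k\<close>
  proof (induction i)
    case (Suc j)
    then show ?case using mono[of j] by simp
  qed simp
  moreover have "x i \<le> x k"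
    using \<open>i \<le> k\<close>
  proof (induction rule: inc_induct)
    case (step j)
    then show ?case using mono[of j] by simp
  qed simp
  ultimately show ?thesis using assms(1) by (simp add: tagged_partition_def)
qed

lemma sum_increments:
  fixes g :: "nat \<Rightarrow> real"
  shows "(\<Sum>i = 1..k. g i - g (i - 1)) = g k - g 0"
  by (induction k) simp_all

lemma riemann_sum_close_to_increment:
  fixes F f :: "real \<Rightarrow> real"
  assumes P: "tagged_partition a b P" "gauge_fine \<delta> P"
    and \<delta>: "\<And>t u v. t \<in> {a..b} \<Longrightarrow> u \<in> {a..b} \<Longrightarrow> v \<in> {a..b} \<Longrightarrow> u \<le> t \<Longrightarrow> t \<le> v \<Longrightarrow>
              v - u < \<delta> t \<Longrightarrow> \<bar>F v - F u - f t * (v - u)\<bar> \<le> \<epsilon> * (v - u)"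
  shows "\<bar>riemann_sum f P - (F b - F a)\<bar> \<le> \<epsilon> * (b - a)"
proof -
  obtain k x t where P_eq: "P = (k, x, t)" by (cases P)
  have ends: "x 0 = a" "x k = b" using P(1) by (auto simp: tagged_partition_def P_eq)
  have piece: "\<bar>F (x i) - F (x (i - 1)) - f (t i) * (x i - x (i - 1))\<bar> \<le> \<epsilon> * (x i - x (i - 1))"
    if i: "i \<in> {1..k}" for i
  proof -
    have "i - 1 \<le> k" "i \<le> k" using i by auto
    then have I: "x (i - 1) \<in> {a..b}" "x i \<in> {a..b}"
      using partition_points_in_interval[OF P(1)[unfolded P_eq]] by blast+
    have t: "x (i - 1) \<le> t i" "t i \<le> x i"
      using P(1) i by (auto simp: tagged_partition_def P_eq)
    have "x i - x (i - 1) < \<delta> (t i)" using P(2) i by (auto simp: gauge_fine_def P_eq)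
    moreover have "t i \<in> {a..b}" using I t by simp
    ultimately show ?thesis using \<delta> I t by blast
  qed
  have "(F b - F a) - riemann_sum f P =
      (\<Sum>i = 1..k. F (x i) - F (x (i - 1)) - f (t i) * (x i - x (i - 1)))"
    using sum_increments[of "\<lambda>i. F (x i)" k] ends
    by (simp add: riemann_sum_def P_eq sum_subtractf)
  also have "\<bar>\<dots>\<bar> \<le> (\<Sum>i = 1..k. \<epsilon> * (x i - x (i - 1)))"
    by (rule order_trans[OF sum_abs sum_mono]) (rule piece)
  also have "\<dots> = \<epsilon> * (b - a)"
    using sum_increments[of x k] ends by (simp flip: sum_distrib_left)
  finally show ?thesis by (simp add: abs_minus_commute)
qed

section \<open>The fundamental theorem\<close>

lemma has_seq_henstock_integral_derivative:
  fixes F f :: "real \<Rightarrow> real"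
  assumes F: "\<And>x. x \<in> {a..b} \<Longrightarrow> (F has_real_derivative f x) (at x within {a..b})"
  shows "has_seq_henstock_integral f (F b - F a) a b"
proof -
  define \<epsilon> where "\<epsilon> n = inverse (real (Suc n))" for n
  define fits where "fits n t d \<longleftrightarrow> (\<forall>u\<in>{a..b}. \<forall>v\<in>{a..b}. u \<le> t \<longrightarrow> t \<le> v \<longrightarrow> v - u < d \<longrightarrow>
      \<bar>F v - F u - f t * (v - u)\<bar> \<le> \<epsilon> n * (v - u))" for n t d
  have "\<exists>d>0. fits n t d" if "t \<in> {a..b}" for n t
    using straddle_estimate[OF F[OF that], of "\<epsilon> n"] by (simp add: \<epsilon>_def fits_def)
  then have "\<forall>n. \<exists>\<delta>. \<forall>t\<in>{a..b}. \<delta> t > 0 \<and> fits n t (\<delta> t)"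
    by (intro allI bchoice) auto
  from choice[OF this] obtain \<delta> where "\<forall>n. \<forall>t\<in>{a..b}. \<delta> n t > 0 \<and> fits n t (\<delta> n t)" ..
  then have \<delta>: "\<delta> n t > 0 \<and> fits n t (\<delta> n t)" if "t \<in> {a..b}" for n t
    using that by blast
  have "(\<lambda>n. riemann_sum f (P n)) \<longlonglongrightarrow> F b - F a"
    if P: "\<And>n. tagged_partition a b (P n) \<and> gauge_fine (\<delta> n) (P n)" for P
  proof -
    have "norm (riemann_sum f (P n) - (F b - F a)) \<le> \<epsilon> n * (b - a)" for n
      unfolding real_norm_def
    proof (rule riemann_sum_close_to_increment)
      show "tagged_partition a b (P n)" "gauge_fine (\<delta> n) (P n)" using P by blast+
    next
      fix t u v
      assume "t \<in> {a..b}" "u \<in> {a..b}" "v \<in> {a..b}" "u \<le> t" "t \<le> v" "v - u < \<delta> n t"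
      then show "\<bar>F v - F u - f t * (v - u)\<bar> \<le> \<epsilon> n * (v - u)"
        using \<delta>[of t n] unfolding fits_def by blast
    qed
    then have bound: "\<forall>n. norm (riemann_sum f (P n) - (F b - F a)) \<le> \<epsilon> n * (b - a)" ..
    have "(\<lambda>n. \<epsilon> n * (b - a)) \<longlonglongrightarrow> 0"
      unfolding \<epsilon>_def by (rule tendsto_mult_left_zero) (rule LIMSEQ_inverse_real_of_nat)
    with always_eventually[OF bound]
    have "(\<lambda>n. riemann_sum f (P n) - (F b - F a)) \<longlonglongrightarrow> 0"
      by (rule Lim_null_comparison)
    then show ?thesis by (rule LIM_zero_cancel)
  qed
  then show ?thesis
    unfolding has_seq_henstock_integral_def gauge_on_def
    using \<delta> by (intro exI[of _ \<delta>] conjI allI ballI impI) blast+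
qed

theorem theorem9:
  fixes a b :: real and f F :: "real \<Rightarrow> real"
  assumes "a \<le> b"
    and "\<And>x. x \<in> {a..b} \<Longrightarrow> (F has_real_derivative f x) (at x within {a..b})"
  shows "seq_henstock_integrable f a b \<and> seq_henstock_integral f a b = F b - F a"
proof -
  have int: "has_seq_henstock_integral f (F b - F a) a b"
    using assms(2) by (rule has_seq_henstock_integral_derivative)
  then have "seq_henstock_integral f a b = F b - F a"
    unfolding seq_henstock_integral_def
    using has_seq_henstock_integral_unique[OF \<open>a \<le> b\<close>] by (intro the_equality) blast+
  with int show ?thesis unfolding seq_henstock_integrable_def by blast
qed

end
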